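(* Let $\langle X,d\rangle$ be a uniformly paracompact metric space. Then $X$ is uniformly star superparacompact if and only if each sequence $\langle x_n\rangle$ in $X$ with $\lim_{n\to\infty}f_c(x_n)=0$ has a Cauchy subsequence.
   Context: Metric spaces are assumed to contain at least two points. $S_d(x,\delta)$ denotes the open ball. For $x\in X$ and $\varepsilon>0$, $S^\infty_d(x,\varepsilon)$ is the set of all $y\in X$ for which there is a finite sequence $x=x_0,x_1,\dots,x_n=y$ in $X$ with $d(x_{i-1},x_i)<\varepsilon$ for $i=1,\dots,n$. Define $f_c(x)=\sup\{\varepsilon>0: S^\infty_d(x,\varepsilon)\text{ is compact}\}\in[0,\infty]$ if $S^\infty_d(x,\varepsilon)$ is compact for some $\varepsilon>0$, and $f_c(x)=0$ otherwise. $X$ is uniformly paracompact if for each open cover $\mathcal V$ of $X$ there exist an open cover $\mathcal U$ of $X$ refining $\mathcal V$ and $\delta>0$ such that for each $x\in X$, $S_d(x,\delta)$ intersects only finitely many members of $\mathcal U$. $X$ is uniformly star superparacompact if for each open cover $\mathcal V$ of $X$ there exist $\mu>0$ and an open cover $\mathcal U$ of $X$ refining $\mathcal V$ such that for each $x\in X$, $S^\infty_d(x,\mu)$ intersects at most finitely many members of $\mathcal U$. ($\mathcal U$ refines $\mathcal V$ if each member of $\mathcal U$ is contained in some member of $\mathcal V$.) *)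

theory Defs
  imports "HOL-Analysis.Analysis"
begin

text \<open>
  A metric space is a type of class \<open>metric_space\<close>; properties of the space as a whole take
  the type as an argument, written \<open>TYPE('a)\<close>.
\<close>

definition open_cover :: "'a::topological_space set set \<Rightarrow> bool" where
  "open_cover \<U> \<longleftrightarrow> (\<forall>U\<in>\<U>. open U) \<and> \<Union>\<U> = UNIV"

definition refines :: "'a set set \<Rightarrow> 'a set set \<Rightarrow> bool" where
  "refines \<U> \<V> \<longleftrightarrow> (\<forall>U\<in>\<U>. \<exists>V\<in>\<V>. U \<subseteq> V)"

definition chain_ball :: "'a::metric_space \<Rightarrow> real \<Rightarrow> 'a set" where
  "chain_ball x \<epsilon> =
     {y. \<exists>(n::nat) s. s 0 = x \<and> s n = y \<and> (\<forall>i\<in>{1..n}. dist (s (i - 1)) (s i) < \<epsilon>)}"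

definition f_c :: "'a::metric_space \<Rightarrow> ennreal" where
  "f_c x =
     (if \<exists>\<epsilon>>0. compact (chain_ball x \<epsilon>)
      then SUP \<epsilon>\<in>{\<epsilon>. 0 < \<epsilon> \<and> compact (chain_ball x \<epsilon>)}. ennreal \<epsilon>
      else 0)"

definition uniformly_paracompact :: "'a::metric_space itself \<Rightarrow> bool" where
  "uniformly_paracompact (_ :: 'a itself) \<longleftrightarrow>
     (\<forall>\<V> :: 'a set set. open_cover \<V> \<longrightarrow>
       (\<exists>\<U> \<delta>. open_cover \<U> \<and> refines \<U> \<V> \<and> \<delta> > 0 \<and>
          (\<forall>x. finite {U\<in>\<U>. ball x \<delta> \<inter> U \<noteq> {}})))"

definition uniformly_star_superparacompact :: "'a::metric_space itself \<Rightarrow> bool" where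
  "uniformly_star_superparacompact (_ :: 'a itself) \<longleftrightarrow>
     (\<forall>\<V> :: 'a set set. open_cover \<V> \<longrightarrow>
       (\<exists>\<mu> \<U>. \<mu> > 0 \<and> open_cover \<U> \<and> refines \<U> \<V> \<and>
          (\<forall>x. finite {U\<in>\<U>. chain_ball x \<mu> \<inter> U \<noteq> {}})))"

end

theory Submission
  imports Defs
begin

text \<open>
  Chain balls of a fixed radius \<open>\<epsilon>\<close> partition the space into clopen sets, each containing the
  \<open>\<epsilon>\<close>-ball around each of its points. Cutting a cover along such a partition turns uniform star
  superparacompactness into a finiteness statement about the given cover: each open cover has a
  \<open>\<mu> > 0\<close> such that every chain ball of radius \<open>\<mu>\<close> is covered by finitely many of its members
  (\<open>uniformly_star_superparacompact_iff\<close>).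

  Suppose this holds. Applied to the cover by open sets meeting \<open>A\<close> finitely, it shows that each
  set \<open>A\<close> without limit points is met finitely by all chain balls of some radius. Let
  \<open>f_c (x n)\<close> tend to 0 and let \<open>x\<close> have no Cauchy subsequence. Its range has no limit point, so
  for some \<open>\<epsilon>\<close> every chain ball of radius \<open>\<epsilon>\<close> contains only finitely many terms. Noncompact
  chain balls around far terms, with radii shrinking to 0, contain infinite sets without limit
  points; those of radius at most \<open>\<epsilon>\<close> do not interfere with each other beyond finitely many at a
  time, so their union has no limit point either. Yet for each \<open>\<mu>\<close> some chain ball of radius \<open>\<mu>\<close>
  contains one of these infinite sets, a contradiction.

  Conversely, uniform paracompactness gives completeness, so the sequences in question have
  convergent subsequences, and the limits are zeros of \<open>f_c\<close> because \<open>f_c\<close> is bounded below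
  near a point where it is positive. Hence the zero set of \<open>f_c\<close> is compact, and finitely many
  members of a given cover, with union \<open>G\<close>, contain it. If no \<open>\<mu>\<close> worked for this cover, there
  would be noncompact chain balls of radii tending to 0 that are not contained in \<open>G\<close>. Points
  of these balls outside \<open>G\<close> have values of \<open>f_c\<close> tending to 0, so they accumulate at a zero of
  \<open>f_c\<close> outside \<open>G\<close>, which is impossible.
\<close>

section \<open>Chain balls\<close>

text \<open>
  As a reflexive transitive closure of a symmetric relation, lying in the same chain ball is an
  equivalence relation, without any manipulation of sequences.
\<close>

lemma chain_ball_rtranclp:
  fixes x :: "'a::metric_space"
  shows "chain_ball x \<epsilon> = {y. (\<lambda>a b. dist a b < \<epsilon>)\<^sup>*\<^sup>* x y}"
proof -
  have shift: "(\<forall>i\<in>{1..n}. dist (s (i - 1)) (s i) < \<epsilon>) \<longleftrightarrow> (\<forall>i<n. dist (s i) (s (Suc i)) < \<epsilon>)"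
    for n :: nat and s :: "nat \<Rightarrow> 'a"
  proof (intro iffI ballI allI impI)
    fix i assume a: "\<forall>i\<in>{1..n}. dist (s (i - 1)) (s i) < \<epsilon>" and "i < n"
    then have "Suc i \<in> {1..n}" by auto
    with a show "dist (s i) (s (Suc i)) < \<epsilon>" by fastforce
  next
    fix i assume a: "\<forall>i<n. dist (s i) (s (Suc i)) < \<epsilon>" and "i \<in> {1..n}"
    then have "i - 1 < n" "Suc (i - 1) = i" by auto
    with a show "dist (s (i - 1)) (s i) < \<epsilon>" by metis
  qed
  show ?thesis
    unfolding chain_ball_def shift rtranclp_power relpowp_fun_conv by blast
qed

lemma chain_ball_refl: "x \<in> chain_ball x \<epsilon>"
  by (simp add: chain_ball_rtranclp)

lemma ball_subset_chain_ball: "ball x \<epsilon> \<subseteq> chain_ball x \<epsilon>"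
  by (auto simp: chain_ball_rtranclp)

lemma chain_ball_eq:
  assumes "y \<in> chain_ball x \<epsilon>"
  shows "chain_ball y \<epsilon> = chain_ball x \<epsilon>"
proof -
  have "symp (\<lambda>a b :: 'a. dist a b < \<epsilon>)"
    by (auto simp: symp_def dist_commute)
  then have "symp (\<lambda>a b :: 'a. dist a b < \<epsilon>)\<^sup>*\<^sup>*"
    by (rule symp_rtranclp)
  then show ?thesis
    using assms unfolding chain_ball_rtranclp
    by (auto dest: sympD intro: rtranclp_trans)
qed

lemma chain_ball_mono:
  assumes "\<delta> \<le> \<epsilon>"
  shows "chain_ball x \<delta> \<subseteq> chain_ball x \<epsilon>"
  unfolding chain_ball_rtranclp
  using assms by (auto elim!: rtranclp_mono[THEN predicate2D, rotated])

lemma open_chain_ball: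
  assumes "\<epsilon> > 0"
  shows "open (chain_ball x \<epsilon>)"
  unfolding open_contains_ball
  using assms ball_subset_chain_ball chain_ball_eq by metis

text \<open>
  The complement is a union of chain balls of the same radius, each of them open.
\<close>

lemma closed_chain_ball:
  assumes "\<epsilon> > 0"
  shows "closed (chain_ball x \<epsilon>)"
proof -
  have "\<exists>T. open T \<and> y \<in> T \<and> T \<subseteq> - chain_ball x \<epsilon>" if "y \<in> - chain_ball x \<epsilon>" for y
  proof (intro exI conjI)
    show "chain_ball y \<epsilon> \<subseteq> - chain_ball x \<epsilon>"
    proof
      fix z assume "z \<in> chain_ball y \<epsilon>"
      with that show "z \<in> - chain_ball x \<epsilon>"
        using chain_ball_eq[of z y \<epsilon>] chain_ball_eq[of z x \<epsilon>] chain_ball_refl[of y \<epsilon>] by auto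
    qed
  qed (use assms in \<open>auto intro: open_chain_ball chain_ball_refl\<close>)
  then have "open (- chain_ball x \<epsilon>)"
    by (subst open_subopen) blast
  then show ?thesis
    by (simp add: closed_def)
qed

section \<open>The radius of compact chain balls\<close>

lemma le_f_c:
  assumes "\<epsilon> > 0" "compact (chain_ball x \<epsilon>)"
  shows "ennreal \<epsilon> \<le> f_c x"
proof -
  have "ennreal \<epsilon> \<le> (SUP \<epsilon>\<in>{\<epsilon>. 0 < \<epsilon> \<and> compact (chain_ball x \<epsilon>)}. ennreal \<epsilon>)"
    using assms by (intro SUP_upper) auto
  then show ?thesis
    using assms unfolding f_c_def by auto
qed

text \<open>
  The radii of compact chain balls around a point are downward closed, since a smaller chain ball
  is a closed subset of a larger one.
\<close>

lemma f_c_le: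
  assumes "\<epsilon> > 0" "\<not> compact (chain_ball x \<epsilon>)"
  shows "f_c x \<le> ennreal \<epsilon>"
proof -
  have "\<delta> \<le> \<epsilon>" if "0 < \<delta>" "compact (chain_ball x \<delta>)" for \<delta>
  proof (rule ccontr)
    assume "\<not> \<delta> \<le> \<epsilon>"
    then have "chain_ball x \<epsilon> = chain_ball x \<delta> \<inter> chain_ball x \<epsilon>"
      using chain_ball_mono[of \<epsilon> \<delta> x] by auto
    then show False
      using assms that closed_chain_ball[of \<epsilon> x] by (metis compact_Int_closed)
  qed
  then show ?thesis
    unfolding f_c_def by (auto intro!: SUP_least ennreal_leI)
qed

text \<open>
  If \<open>chain_ball z \<epsilon>\<close> is compact, then it is also the chain ball of radius \<open>\<epsilon>\<close> of all points near
  \<open>z\<close>, whose values of \<open>f_c\<close> are therefore at least \<open>\<epsilon>\<close>.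
\<close>

lemma f_c_limit_eq_0:
  assumes "x \<longlonglongrightarrow> z" "(\<lambda>n. f_c (x n)) \<longlonglongrightarrow> 0"
  shows "f_c z = 0"
proof (rule ccontr)
  assume "f_c z \<noteq> 0"
  then obtain \<epsilon> where \<epsilon>: "\<epsilon> > 0" "compact (chain_ball z \<epsilon>)"
    unfolding f_c_def by (auto split: if_splits)
  have "z \<in> ball z \<epsilon>" using \<epsilon> by simp
  then have "\<forall>\<^sub>F n in sequentially. x n \<in> ball z \<epsilon>"
    using assms(1) open_ball topological_tendstoD by blast
  moreover have "\<forall>\<^sub>F n in sequentially. f_c (x n) < ennreal \<epsilon>"
    using assms(2) \<epsilon>(1) by (auto intro: order_tendstoD)
  ultimately have "\<forall>\<^sub>F n in sequentially. False"
  proof eventually_elim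
    case (elim n)
    then have "chain_ball (x n) \<epsilon> = chain_ball z \<epsilon>"
      using ball_subset_chain_ball chain_ball_eq by blast
    then have "ennreal \<epsilon> \<le> f_c (x n)"
      using \<epsilon> by (auto intro: le_f_c)
    with elim show False by simp
  qed
  then show False by simp
qed

section \<open>Finite covers of chain balls\<close>

text \<open>
  From right to left, the refinement is obtained by intersecting the finite subfamily belonging to
  a chain ball with that chain ball. Distinct chain balls of radius \<open>\<mu>\<close> are disjoint, so each
  of them meets only its own pieces.
\<close>

lemma uniformly_star_superparacompact_iff:
  "uniformly_star_superparacompact TYPE('a::metric_space) \<longleftrightarrow>
    (\<forall>\<V> :: 'a set set. open_cover \<V> \<longrightarrow>
      (\<exists>\<mu>>0. \<forall>x. \<exists>\<F>\<subseteq>\<V>. finite \<F> \<and> chain_ball x \<mu> \<subseteq> \<Union>\<F>))"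
    (is "?uss \<longleftrightarrow> ?fin")
proof
  assume ?uss
  show ?fin
  proof (intro allI impI)
    fix \<V> :: "'a set set" assume "open_cover \<V>"
    with \<open>?uss\<close> obtain \<mu> \<U> where \<mu>: "\<mu> > 0" and "open_cover \<U>" "refines \<U> \<V>"
      and fin: "\<And>x. finite {U\<in>\<U>. chain_ball x \<mu> \<inter> U \<noteq> {}}"
      unfolding uniformly_star_superparacompact_def by blast
    then obtain V where V: "\<And>U. U \<in> \<U> \<Longrightarrow> V U \<in> \<V> \<and> U \<subseteq> V U"
      unfolding refines_def by metis
    have "\<exists>\<F>\<subseteq>\<V>. finite \<F> \<and> chain_ball x \<mu> \<subseteq> \<Union>\<F>" for x
    proof (intro exI conjI)
      show "V ` {U\<in>\<U>. chain_ball x \<mu> \<inter> U \<noteq> {}} \<subseteq> \<V>"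
        using V by blast
      show "finite (V ` {U\<in>\<U>. chain_ball x \<mu> \<inter> U \<noteq> {}})"
        using fin by blast
      show "chain_ball x \<mu> \<subseteq> \<Union> (V ` {U\<in>\<U>. chain_ball x \<mu> \<inter> U \<noteq> {}})"
        using V \<open>open_cover \<U>\<close> unfolding open_cover_def by blast
    qed
    with \<mu> show "\<exists>\<mu>>0. \<forall>x. \<exists>\<F>\<subseteq>\<V>. finite \<F> \<and> chain_ball x \<mu> \<subseteq> \<Union>\<F>"
      by blast
  qed
next
  assume ?fin
  show ?uss
    unfolding uniformly_star_superparacompact_def
  proof (intro allI impI)
    fix \<V> :: "'a set set" assume \<V>: "open_cover \<V>"
    from \<open>?fin\<close>[THEN spec, THEN mp, OF \<V>] obtain \<mu> where \<mu>: "\<mu> > 0"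
      and ex: "\<forall>x. \<exists>\<F>\<subseteq>\<V>. finite \<F> \<and> chain_ball x \<mu> \<subseteq> \<Union>\<F>"
      by (elim exE conjE)
    \<comment> \<open>The finite family is chosen per chain ball, not per centre: all points of a chain ball
      must agree on it.\<close>
    have "\<forall>D\<in>range (\<lambda>x. chain_ball x \<mu>). \<exists>\<F>. \<F> \<subseteq> \<V> \<and> finite \<F> \<and> D \<subseteq> \<Union>\<F>"
      using ex by blast
    from bchoice[OF this] obtain F where
      "\<forall>D\<in>range (\<lambda>x. chain_ball x \<mu>). F D \<subseteq> \<V> \<and> finite (F D) \<and> D \<subseteq> \<Union> (F D)" ..
    then have F: "F (chain_ball x \<mu>) \<subseteq> \<V>" "finite (F (chain_ball x \<mu>))"
        "chain_ball x \<mu> \<subseteq> \<Union> (F (chain_ball x \<mu>))" for x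
      by simp_all
    let ?\<U> = "\<Union>x. (\<lambda>V. V \<inter> chain_ball x \<mu>) ` F (chain_ball x \<mu>)"
    have "open_cover ?\<U>"
    proof -
      have "\<forall>U\<in>?\<U>. open U"
      proof safe
        fix x V assume "V \<in> F (chain_ball x \<mu>)"
        then have "V \<in> \<V>" using F(1) by (rule rev_subsetD)
        then show "open (V \<inter> chain_ball x \<mu>)"
          using \<V> open_chain_ball[OF \<mu>, of x] by (simp add: open_cover_def open_Int)
      qed
      moreover have "x \<in> \<Union>?\<U>" for x
      proof -
        obtain V where "V \<in> F (chain_ball x \<mu>)" "x \<in> V"
          using F(3)[of x] chain_ball_refl[of x \<mu>] by (meson UnionE subsetD)
        then show ?thesis
          using chain_ball_refl[of x \<mu>] by (intro UnionI[of "V \<inter> chain_ball x \<mu>"]) auto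
      qed
      ultimately show ?thesis
        unfolding open_cover_def by (intro conjI) auto
    qed
    moreover have "refines ?\<U> \<V>"
      unfolding refines_def
    proof safe
      fix x V assume "V \<in> F (chain_ball x \<mu>)"
      then have "V \<in> \<V>" using F(1) by (rule rev_subsetD)
      then show "\<exists>W\<in>\<V>. V \<inter> chain_ball x \<mu> \<subseteq> W" by blast
    qed
    moreover have "finite {U\<in>?\<U>. chain_ball x \<mu> \<inter> U \<noteq> {}}" for x
    proof (rule finite_subset)
      show "{U\<in>?\<U>. chain_ball x \<mu> \<inter> U \<noteq> {}}
          \<subseteq> (\<lambda>V. V \<inter> chain_ball x \<mu>) ` F (chain_ball x \<mu>)"
      proof
        fix U assume "U \<in> {U\<in>?\<U>. chain_ball x \<mu> \<inter> U \<noteq> {}}"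
        then obtain y V z where U: "V \<in> F (chain_ball y \<mu>)" "U = V \<inter> chain_ball y \<mu>"
          and z: "z \<in> chain_ball x \<mu>" "z \<in> chain_ball y \<mu>"
          by blast
        from z have "chain_ball y \<mu> = chain_ball x \<mu>"
          using chain_ball_eq by metis
        with U show "U \<in> (\<lambda>V. V \<inter> chain_ball x \<mu>) ` F (chain_ball x \<mu>)"
          by simp
      qed
      show "finite ((\<lambda>V. V \<inter> chain_ball x \<mu>) ` F (chain_ball x \<mu>))"
        using F(2) by (rule finite_imageI)
    qed
    ultimately show "\<exists>\<mu> \<U>. \<mu> > 0 \<and> open_cover \<U> \<and> refines \<U> \<V> \<and>
          (\<forall>x. finite {U\<in>\<U>. chain_ball x \<mu> \<inter> U \<noteq> {}})"
      using \<mu> by blast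
  qed
qed

section \<open>Sets without limit points\<close>

text \<open>
  This cover converts covering properties into statements about how often sets of a given size meet
  a set without limit points.
\<close>

lemma open_cover_finite_Int:
  fixes A :: "'a::metric_space set"
  assumes "\<And>x. \<not> x islimpt A"
  shows "open_cover {V. open V \<and> finite (V \<inter> A)}"
proof -
  have "\<exists>V. open V \<and> finite (V \<inter> A) \<and> x \<in> V" for x
    using assms[of x] unfolding islimpt_eq_acc_point by (auto simp: Int_commute)
  then show ?thesis
    unfolding open_cover_def by blast
qed

lemma uniformly_star_superparacompact_finite_Int:
  fixes A :: "'a::metric_space set"
  assumes "uniformly_star_superparacompact TYPE('a)" "\<And>x. \<not> x islimpt A"
  obtains \<mu> where "\<mu> > 0" "\<And>x. finite (chain_ball x \<mu> \<inter> A)"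
proof -
  from assms(1)[unfolded uniformly_star_superparacompact_iff, THEN spec, THEN mp,
      OF open_cover_finite_Int[OF assms(2)]]
  obtain \<mu> where \<mu>: "\<mu> > 0"
    and F: "\<And>x. \<exists>\<F>\<subseteq>{V. open V \<and> finite (V \<inter> A)}. finite \<F> \<and> chain_ball x \<mu> \<subseteq> \<Union>\<F>"
    by (elim exE conjE) (rule that, (assumption | erule spec)+)
  have "finite (chain_ball x \<mu> \<inter> A)" for x
  proof -
    from F[of x] obtain \<F> where \<F>: "\<F> \<subseteq> {V. open V \<and> finite (V \<inter> A)}" "finite \<F>"
      "chain_ball x \<mu> \<subseteq> \<Union>\<F>" by blast
    then have "finite (\<Union>V\<in>\<F>. V \<inter> A)" by (intro finite_UN_I) auto
    then show ?thesis
      by (rule rev_finite_subset) (use \<F> in blast)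
  qed
  with \<mu> show ?thesis by (rule that)
qed

text \<open>
  The local counterpart of the previous lemma; it makes uniformly paracompact spaces complete.
\<close>

lemma uniformly_paracompact_finite_Int:
  fixes A :: "'a::metric_space set"
  assumes "uniformly_paracompact TYPE('a)" "\<And>x. \<not> x islimpt A"
  obtains \<delta> where "\<delta> > 0" "\<And>x. finite (ball x \<delta> \<inter> A)"
proof -
  from assms(1)[unfolded uniformly_paracompact_def, THEN spec, THEN mp,
      OF open_cover_finite_Int[OF assms(2)]]
  obtain \<U> \<delta> where \<delta>: "\<delta> > 0"
    and U: "open_cover \<U>" "refines \<U> {V. open V \<and> finite (V \<inter> A)}"
    and fin: "\<And>x. finite {U\<in>\<U>. ball x \<delta> \<inter> U \<noteq> {}}"
    by (elim exE conjE) (rule that, (assumption | erule spec)+)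
  have "finite (ball x \<delta> \<inter> A)" for x
  proof -
    have "finite (U \<inter> A)" if "U \<in> \<U>" for U
    proof -
      from U(2) that obtain V where "finite (V \<inter> A)" "U \<subseteq> V"
        unfolding refines_def by auto
      then show ?thesis by (meson Int_mono finite_subset order_refl)
    qed
    with fin[of x] have "finite (\<Union>U\<in>{U\<in>\<U>. ball x \<delta> \<inter> U \<noteq> {}}. U \<inter> A)"
      by (intro finite_UN_I) simp_all
    moreover have "ball x \<delta> \<inter> A \<subseteq> (\<Union>U\<in>{U\<in>\<U>. ball x \<delta> \<inter> U \<noteq> {}}. U \<inter> A)"
    proof
      fix y assume y: "y \<in> ball x \<delta> \<inter> A"
      obtain U where "U \<in> \<U>" "y \<in> U"
        using U(1) unfolding open_cover_def by (metis UNIV_I UnionE)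
      with y show "y \<in> (\<Union>U\<in>{U\<in>\<U>. ball x \<delta> \<inter> U \<noteq> {}}. U \<inter> A)"
        by (intro UN_I[of U]) auto
    qed
    ultimately show ?thesis
      by (rule finite_subset[rotated])
  qed
  with \<delta> show ?thesis by (rule that)
qed

lemma discrete_range_if_no_limit:
  fixes x :: "nat \<Rightarrow> 'a::metric_space"
  assumes "\<And>r z. strict_mono r \<Longrightarrow> \<not> (x \<circ> r) \<longlonglongrightarrow> z"
  shows "\<not> z islimpt range x" "finite {n. x n = a}"
proof -
  show fin: "finite {n. x n = a}" for a
  proof (rule ccontr)
    assume inf: "infinite {n. x n = a}"
    then have "strict_mono (enumerate {n. x n = a})"
      by (rule strict_mono_enumerate)
    moreover have "x \<circ> enumerate {n. x n = a} = (\<lambda>_. a)"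
      using enumerate_in_set[OF inf] by auto
    ultimately show False
      using assms[of "enumerate {n. x n = a}" a] by simp
  qed
  show "\<not> z islimpt range x"
    using assms islimpt_range_imp_convergent_subsequence by metis
qed

text \<open>
  A divergent Cauchy sequence has a range without limit points, but a ball of any prescribed radius
  contains one of its tails.
\<close>

lemma uniformly_paracompact_Cauchy_convergent:
  fixes x :: "nat \<Rightarrow> 'a::metric_space"
  assumes "uniformly_paracompact TYPE('a)" "Cauchy x"
  shows "\<exists>z. x \<longlonglongrightarrow> z"
proof (rule ccontr)
  assume "\<nexists>z. x \<longlonglongrightarrow> z"
  then have no: "\<not> (x \<circ> r) \<longlonglongrightarrow> z" if "strict_mono r" for r z
    using that assms(2) Cauchy_converges_subseq by blast
  obtain \<delta> where "\<delta> > 0" and fin: "\<And>x'. finite (ball x' \<delta> \<inter> range x)"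
    by (rule uniformly_paracompact_finite_Int[OF assms(1) discrete_range_if_no_limit(1)[OF no]])
      (assumption, rule that)
  obtain N where "\<And>n. n \<ge> N \<Longrightarrow> x n \<in> ball (x N) \<delta>"
    using assms(2) \<open>\<delta> > 0\<close> by (auto simp: Cauchy_def) (metis order_refl)
  then have "{N..} \<subseteq> (\<Union>a\<in>ball (x N) \<delta> \<inter> range x. {n. x n = a})" by auto
  moreover have "finite \<dots>"
    using fin discrete_range_if_no_limit(2)[OF no] by (intro finite_UN_I)
  ultimately show False
    using infinite_Ici finite_subset by blast
qed

section \<open>Sequences along which the compactness radius vanishes\<close>

text \<open>
  Finite intersection with chain balls is used twice: to spread the terms of the sequence over
  many chain balls of one radius \<open>\<epsilon>\<close>, and then to refute a set \<open>B\<close> assembled from infinite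
  discrete pieces of ever smaller chain balls around these terms.
\<close>

lemma uniformly_star_superparacompact_Cauchy_subseq:
  fixes x :: "nat \<Rightarrow> 'a::metric_space"
  assumes uss: "uniformly_star_superparacompact TYPE('a)" and lim: "(\<lambda>n. f_c (x n)) \<longlonglongrightarrow> 0"
  shows "\<exists>r :: nat \<Rightarrow> nat. strict_mono r \<and> Cauchy (x \<circ> r)"
proof (rule ccontr)
  assume "\<not> ?thesis"
  then have no: "\<not> (x \<circ> r) \<longlonglongrightarrow> z" if "strict_mono r" for r z
    using that LIMSEQ_imp_Cauchy by blast
  obtain \<epsilon> where \<epsilon>: "\<epsilon> > 0" and "\<And>y. finite (chain_ball y \<epsilon> \<inter> range x)"
    by (rule uniformly_star_superparacompact_finite_Int[OF uss discrete_range_if_no_limit(1)[OF no]])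
      (assumption, rule that)
  then have "finite (\<Union>a\<in>chain_ball y \<epsilon> \<inter> range x. {n. x n = a})" for y
    using discrete_range_if_no_limit(2)[OF no] by (intro finite_UN_I)
  then have fin: "finite {n. x n \<in> chain_ball y \<epsilon>}" for y
    by (rule rev_finite_subset) auto
  have "\<exists>k\<ge>n. \<not> compact (chain_ball (x k) (1 / Suc n))" for n
  proof -
    have "\<forall>\<^sub>F k in sequentially. f_c (x k) < ennreal (1 / Suc n)"
      using lim by (auto intro: order_tendstoD)
    then obtain k where "k \<ge> n" "f_c (x k) < ennreal (1 / Suc n)"
      unfolding eventually_sequentially by (metis nle_le)
    then show ?thesis
      using le_f_c[of "1 / Suc n" "x k"] by (auto simp: not_less[symmetric])
  qed
  \<comment> \<open>\<open>k\<close> need not be increasing: \<open>k n \<ge> n\<close> already makes it finite-to-one.\<close>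
  then obtain k where k: "\<And>n. k n \<ge> n" "\<And>n. \<not> compact (chain_ball (x (k n)) (1 / Suc n))"
    by metis
  have "\<exists>A\<subseteq>chain_ball (x (k n)) (1 / Suc n). infinite A \<and> (\<forall>z. \<not> z islimpt A)" for n
  proof -
    from k(2)[of n] obtain A where A: "A \<subseteq> chain_ball (x (k n)) (1 / Suc n)" "infinite A"
      "\<forall>z\<in>chain_ball (x (k n)) (1 / Suc n). \<not> z islimpt A"
      unfolding compact_eq_Bolzano_Weierstrass by blast
    moreover have "closed (chain_ball (x (k n)) (1 / Suc n))"
      by (simp add: closed_chain_ball)
    ultimately show ?thesis
      by (metis closed_limpt islimpt_subset)
  qed
  then obtain A where A: "\<And>n. A n \<subseteq> chain_ball (x (k n)) (1 / Suc n)" "\<And>n. infinite (A n)"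
    "\<And>n z. \<not> z islimpt A n"
    by metis
  \<comment> \<open>The restriction on \<open>n\<close> confines each piece to a single chain ball of radius \<open>\<epsilon>\<close>.\<close>
  define B where "B = (\<Union>n\<in>{n. 1 / Suc n \<le> \<epsilon>}. A n)"
  have "\<not> z islimpt B" for z
  proof
    assume "z islimpt B"
    let ?N = "{n. x (k n) \<in> chain_ball z \<epsilon>}"
    have "finite ?N"
    proof (rule finite_subset)
      show "?N \<subseteq> (\<Union>m\<in>{m. x m \<in> chain_ball z \<epsilon>}. {..m})"
        using k(1) by auto
    qed (use fin in auto)
    have "B \<inter> chain_ball z \<epsilon> \<subseteq> (\<Union>n\<in>?N. A n)"
    proof
      fix b assume b: "b \<in> B \<inter> chain_ball z \<epsilon>"
      then obtain n where n: "b \<in> A n" "1 / Suc n \<le> \<epsilon>"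
        unfolding B_def by auto
      then have "b \<in> chain_ball (x (k n)) \<epsilon>"
        using A(1) chain_ball_mono by blast
      then have "chain_ball (x (k n)) \<epsilon> = chain_ball z \<epsilon>"
        using b chain_ball_eq by (metis Int_iff)
      then show "b \<in> (\<Union>n\<in>?N. A n)"
        using n(1) chain_ball_refl[of "x (k n)" \<epsilon>] by auto
    qed
    moreover have "z islimpt (B \<inter> chain_ball z \<epsilon>)"
      using \<open>z islimpt B\<close> open_chain_ball[OF \<epsilon>, of z] chain_ball_refl[of z \<epsilon>]
      by (intro islimpt_Int_eventually eventually_at_in_open')
    ultimately have "z islimpt (\<Union>n\<in>?N. A n)"
      by (rule islimpt_subset[rotated])
    then show False
      using \<open>finite ?N\<close> A(3) by (simp add: islimpt_finite_union_iff)
  qed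
  then obtain \<mu> where \<mu>: "\<mu> > 0" "\<And>y. finite (chain_ball y \<mu> \<inter> B)"
    using uniformly_star_superparacompact_finite_Int[OF uss, of B] by metis
  obtain n where n: "1 / Suc n < min \<epsilon> \<mu>"
    using \<epsilon> \<mu>(1) nat_approx_posE[of "min \<epsilon> \<mu>"] by auto
  then have "A n \<subseteq> chain_ball (x (k n)) \<mu>"
    using A(1)[of n] chain_ball_mono[of "1 / Suc n" \<mu> "x (k n)"] by auto
  moreover have "A n \<subseteq> B"
    unfolding B_def by (rule UN_upper) (use n in simp)
  ultimately have "A n \<subseteq> chain_ball (x (k n)) \<mu> \<inter> B"
    by (rule Int_greatest)
  then show False
    using \<mu>(2) A(2) finite_subset by blast
qed

text \<open>
  The zero set of \<open>f_c\<close> is compact, and a chain ball that is not finitely covered must leave every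
  finite subcover \<open>\<G>\<close> of this zero set. All its points share its noncompactness, so \<open>f_c\<close> is
  small at the point \<open>y n\<close> where it leaves.
\<close>

lemma uniformly_star_superparacompactI:
  assumes sub: "\<And>x :: nat \<Rightarrow> 'a::metric_space. (\<lambda>n. f_c (x n)) \<longlonglongrightarrow> 0 \<Longrightarrow>
    \<exists>r z. strict_mono r \<and> (x \<circ> r) \<longlonglongrightarrow> z"
  shows "uniformly_star_superparacompact TYPE('a)"
proof -
  have sub0: "\<exists>z r. strict_mono r \<and> (x \<circ> r) \<longlonglongrightarrow> z \<and> f_c z = 0"
    if "(\<lambda>n. f_c (x n)) \<longlonglongrightarrow> 0" for x :: "nat \<Rightarrow> 'a"
  proof -
    from sub[OF that] obtain r z where "strict_mono r" "(x \<circ> r) \<longlonglongrightarrow> z" by blast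
    moreover from this have "f_c z = 0"
      using LIMSEQ_subseq_LIMSEQ[OF that] by (intro f_c_limit_eq_0) (auto simp: o_def)
    ultimately show ?thesis by blast
  qed
  have comp: "compact {z :: 'a. f_c z = 0}"
    unfolding compact_eq_seq_compact_metric
  proof (rule seq_compactI)
    fix x :: "nat \<Rightarrow> 'a" assume "\<forall>n. x n \<in> {z. f_c z = 0}"
    then have "(\<lambda>n. f_c (x n)) \<longlonglongrightarrow> 0" by simp
    from sub0[OF this] show "\<exists>l\<in>{z. f_c z = 0}. \<exists>r. strict_mono r \<and> (x \<circ> r) \<longlonglongrightarrow> l" by blast
  qed
  show ?thesis
    unfolding uniformly_star_superparacompact_iff
  proof (intro allI impI, rule ccontr)
    fix \<V> :: "'a set set" assume \<V>: "open_cover \<V>"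
    assume "\<not> (\<exists>\<mu>>0. \<forall>x. \<exists>\<F>\<subseteq>\<V>. finite \<F> \<and> chain_ball x \<mu> \<subseteq> \<Union>\<F>)"
    then have "\<And>n. \<exists>x. \<forall>\<F>\<subseteq>\<V>. finite \<F> \<longrightarrow> \<not> chain_ball x (1 / Suc n) \<subseteq> \<Union>\<F>"
      by (metis of_nat_0_less_iff zero_less_Suc zero_less_divide_1_iff)
    then obtain x where
      x: "\<And>n \<F>. \<F> \<subseteq> \<V> \<Longrightarrow> finite \<F> \<Longrightarrow> \<not> chain_ball (x n) (1 / Suc n) \<subseteq> \<Union>\<F>"
      by metis
    have subcover: "\<exists>\<G>\<subseteq>\<V>. finite \<G> \<and> C \<subseteq> \<Union>\<G>" if "compact C" for C
      using compactE[OF that, of \<V>] \<V> unfolding open_cover_def by (metis top_greatest)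
    from subcover[OF comp] obtain \<G> where
      \<G>: "\<G> \<subseteq> \<V>" "finite \<G>" "{z. f_c z = 0} \<subseteq> \<Union>\<G>"
      by auto
    have "\<exists>y. y \<in> chain_ball (x n) (1 / Suc n) \<and> y \<notin> \<Union>\<G>" for n
      using x[OF \<G>(1,2), of n] by blast
    then obtain y where y: "\<And>n. y n \<in> chain_ball (x n) (1 / Suc n)" "\<And>n. y n \<notin> \<Union>\<G>"
      by metis
    have le: "f_c (y n) \<le> ennreal (1 / Suc n)" for n
    proof (rule f_c_le)
      have "\<not> compact (chain_ball (x n) (1 / Suc n))"
        using subcover x by metis
      then show "\<not> compact (chain_ball (y n) (1 / Suc n))"
        using chain_ball_eq[OF y(1)] by simp
    qed simp
    have "(\<lambda>n. ennreal (1 / Suc n)) \<longlonglongrightarrow> ennreal 0"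
      by (intro tendsto_ennrealI LIMSEQ_Suc lim_1_over_n)
    then have "(\<lambda>n. f_c (y n)) \<longlonglongrightarrow> 0"
      unfolding ennreal_0
      by (rule tendsto_sandwich[OF _ _ tendsto_const, rotated 2])
        (intro always_eventually allI zero_le le)+
    from sub0[OF this] obtain z r where z: "(y \<circ> r) \<longlonglongrightarrow> z" "f_c z = 0" by blast
    have "closed (- \<Union>\<G>)"
      using \<G>(1) \<V> unfolding open_cover_def by (intro closed_Compl open_Union) auto
    then have "z \<in> - \<Union>\<G>"
      by (rule closed_sequentially[OF _ _ z(1)]) (use y(2) in auto)
    with \<G>(3) z(2) show False by blast
  qed
qed

theorem mainTheorem4:
  assumes "\<exists>a b :: 'a::metric_space. a \<noteq> b"
    and "uniformly_paracompact TYPE('a)"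
  shows "uniformly_star_superparacompact TYPE('a) \<longleftrightarrow>
    (\<forall>x :: nat \<Rightarrow> 'a. (\<lambda>n. f_c (x n)) \<longlonglongrightarrow> 0 \<longrightarrow>
       (\<exists>r :: nat \<Rightarrow> nat. strict_mono r \<and> Cauchy (x \<circ> r)))"
proof
  assume "uniformly_star_superparacompact TYPE('a)"
  then show "\<forall>x :: nat \<Rightarrow> 'a. (\<lambda>n. f_c (x n)) \<longlonglongrightarrow> 0 \<longrightarrow>
       (\<exists>r :: nat \<Rightarrow> nat. strict_mono r \<and> Cauchy (x \<circ> r))"
    using uniformly_star_superparacompact_Cauchy_subseq by blast
next
  assume cauchy: "\<forall>x :: nat \<Rightarrow> 'a. (\<lambda>n. f_c (x n)) \<longlonglongrightarrow> 0 \<longrightarrow>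
       (\<exists>r :: nat \<Rightarrow> nat. strict_mono r \<and> Cauchy (x \<circ> r))"
  show "uniformly_star_superparacompact TYPE('a)"
  proof (rule uniformly_star_superparacompactI)
    fix x :: "nat \<Rightarrow> 'a" assume "(\<lambda>n. f_c (x n)) \<longlonglongrightarrow> 0"
    with cauchy obtain r where r: "strict_mono r" "Cauchy (x \<circ> r)" by metis
    with uniformly_paracompact_Cauchy_convergent[OF assms(2) r(2)]
    show "\<exists>r z. strict_mono r \<and> (x \<circ> r) \<longlonglongrightarrow> z" by metis
  qed
qed

end
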